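(* Let $U=\{\mathbf{x}=(x_1,x_2,x_3)\in\mathbb{R}^3 : |\mathbf{x}-(0,0,1)|<1,\ x_2>0\}$ and let $A\subset\mathbb{R}$ be an infinite set. If $f\in C^\infty(\mathbb{R}^3)$ has compact support in $U$ and $Cf(u,\beta,s)=0$ for all $(u,\beta,s)\in A\times[0,2\pi)\times[-1,1]$, then $f=0$.
   Context: The conical Radon transform of a compactly supported function $f\in C^\infty(\mathbb{R}^3)$ is defined, for $u\in\mathbb{R}$, $\beta\in[0,2\pi)$, $s\in[-1,1]$, by $$Cf(u,\beta,s)=\int_{S^2}\int_0^\infty f((u,0,0)+r\boldsymbol\alpha)\,r\,\delta(\boldsymbol\alpha\cdot\boldsymbol\beta-s)\,{\rm d}r\,{\rm d}S(\boldsymbol\alpha),\qquad \boldsymbol\beta=(\cos\beta,0,\sin\beta)\in S^2,$$ where $\delta$ is the Dirac delta and ${\rm d}S$ is the standard surface measure on the unit sphere $S^2\subset\mathbb{R}^3$. Explicitly, for continuous $\phi$ on $S^2$ and $s\in[-1,1]$, $$\int_{S^2}\phi(\boldsymbol\alpha)\,\delta(\boldsymbol\alpha\cdot\boldsymbol\beta-s)\,{\rm d}S(\boldsymbol\alpha)=\int_0^{2\pi}\phi\big(s\boldsymbol\beta+\sqrt{1-s^2}\,(\cos\theta\,\mathbf{e}_1+\sin\theta\,\mathbf{e}_2)\big)\,{\rm d}\theta,$$ where $\mathbf{e}_1,\mathbf{e}_2$ is any orthonormal basis of $\boldsymbol\beta^\perp$; $Cf$ is obtained with $\phi(\boldsymbol\alpha)=\int_0^\infty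 f((u,0,0)+r\boldsymbol\alpha)\,r\,{\rm d}r$. "Compact support in $U$" means that the support of $f$ is a compact subset of $U$. *)

theory Defs
  imports "HOL-Analysis.Analysis"
begin

primrec continuously_differentiable_times ::
    "nat \<Rightarrow> ('a::euclidean_space \<Rightarrow> 'b::real_normed_vector) \<Rightarrow> bool" where
  "continuously_differentiable_times 0 f \<longleftrightarrow> continuous_on UNIV f"
| "continuously_differentiable_times (Suc n) f \<longleftrightarrow>
     (\<forall>x. f differentiable (at x)) \<and>
     (\<forall>v. continuously_differentiable_times n (\<lambda>x. frechet_derivative f (at x) v))"

definition smooth :: "('a::euclidean_space \<Rightarrow> 'b::real_normed_vector) \<Rightarrow> bool" where
  "smooth f \<longleftrightarrow> (\<forall>n. continuously_differentiable_times n f)"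

definition topological_support :: "('a::topological_space \<Rightarrow> 'b::zero) \<Rightarrow> 'a set" where
  "topological_support f = closure {x. f x \<noteq> 0}"

definition compact_support_in :: "('a::topological_space \<Rightarrow> 'b::zero) \<Rightarrow> 'a set \<Rightarrow> bool" where
  "compact_support_in f U \<longleftrightarrow> compact (topological_support f) \<and> topological_support f \<subseteq> U"

text \<open>
  The integral of \<open>\<phi>\<close> against \<open>\<delta>(\<alpha> \<bullet> b - s)\<close> over the unit sphere, where \<open>e1\<close>, \<open>e2\<close> is an
  orthonormal basis of the orthogonal complement of the unit vector \<open>b\<close>. This is an integral over
  the angle, not arc length: the factor \<open>sqrt (1 - s\<^sup>2)\<close> of the length element cancels.
\<close>
definition sphere_delta_integral ::
    "(real^3 \<Rightarrow> real) \<Rightarrow> real^3 \<Rightarrow> real^3 \<Rightarrow> real^3 \<Rightarrow> real \<Rightarrow> real" where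
  "sphere_delta_integral \<phi> b e1 e2 s =
     (LINT \<theta>:{0..2*pi}|lborel.
        \<phi> (s *\<^sub>R b + sqrt (1 - s\<^sup>2) *\<^sub>R (cos \<theta> *\<^sub>R e1 + sin \<theta> *\<^sub>R e2)))"

definition orthonormal_complement_basis :: "real^3 \<Rightarrow> real^3 \<Rightarrow> real^3 \<Rightarrow> bool" where
  "orthonormal_complement_basis b e1 e2 \<longleftrightarrow>
     norm e1 = 1 \<and> norm e2 = 1 \<and> orthogonal e1 e2 \<and> orthogonal b e1 \<and> orthogonal b e2"

definition cone_axis :: "real \<Rightarrow> real^3" where
  "cone_axis \<beta> = vector [cos \<beta>, 0, sin \<beta>]"

definition weighted_ray_integral :: "(real^3 \<Rightarrow> real) \<Rightarrow> real \<Rightarrow> real^3 \<Rightarrow> real" where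
  "weighted_ray_integral f u \<alpha> = (LINT r:{0..}|lborel. f (vector [u, 0, 0] + r *\<^sub>R \<alpha>) * r)"

text \<open>
  A particular orthonormal basis of the complement of the axis is fixed here; by
  \<open>conical_radon_basis_independent\<close> below any other choice gives the same value whenever
  \<open>\<alpha> \<mapsto> weighted_ray_integral f u \<alpha>\<close> is continuous on the sphere, as it is for continuous \<open>f\<close>
  with compact support.
\<close>
definition conical_radon :: "(real^3 \<Rightarrow> real) \<Rightarrow> real \<Rightarrow> real \<Rightarrow> real \<Rightarrow> real" where
  "conical_radon f u \<beta> s =
     sphere_delta_integral (weighted_ray_integral f u) (cone_axis \<beta>)
       (vector [0, 1, 0]) (vector [- sin \<beta>, 0, cos \<beta>]) s"

lemma norm_cone_axis: "norm (cone_axis \<beta>) = 1"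
  by (simp add: cone_axis_def norm_eq_1 inner_vec_def sum_3 power2_eq_square[symmetric])

lemma orthonormal_complement_basis_cone_axis:
  "orthonormal_complement_basis (cone_axis \<beta>) (vector [0, 1, 0]) (vector [- sin \<beta>, 0, cos \<beta>])"
  by (simp add: orthonormal_complement_basis_def cone_axis_def norm_eq_1 orthogonal_def
      inner_vec_def sum_3 power2_eq_square[symmetric])

lemma integral_period_shift:
  fixes g :: "real \<Rightarrow> real"
  assumes cont: "continuous_on UNIV g" and per: "\<And>x. g (x + 2*pi) = g x"
    and t: "0 \<le> t" "t \<le> 2*pi"
  shows "integral {0..2*pi} (\<lambda>x. g (x + t)) = integral {0..2*pi} g"
proof -
  have int: "g integrable_on {a..b}" for a b
    using cont by (meson continuous_on_subset integrable_continuous_real subset_UNIV)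
  have "integral {0..2*pi} (\<lambda>x. g (x + t)) = integral {t..2*pi + t} g"
    using integral_shift_real_ivl[of t t "2*pi + t" g] by simp
  also have "\<dots> = integral {t..2*pi} g + integral {2*pi..2*pi + t} g"
    using Henstock_Kurzweil_Integration.integral_combine[of t "2*pi" "2*pi + t" g] int t by simp
  also have "integral {2*pi..2*pi + t} g = integral {0..t} g"
    using integral_shift_real_ivl[of "2*pi" "2*pi" "2*pi + t" g] per by simp
  also have "integral {t..2*pi} g + integral {0..t} g = integral {0..2*pi} g"
    using Henstock_Kurzweil_Integration.integral_combine[of 0 t "2*pi" g] int t by simp
  finally show ?thesis .
qed

lemma integral_period_reflect_shift:
  fixes g :: "real \<Rightarrow> real"
  assumes cont: "continuous_on UNIV g" and per: "\<And>x. g (x + 2*pi) = g x"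
    and t: "0 \<le> t" "t \<le> 2*pi"
  shows "integral {0..2*pi} (\<lambda>x. g (t - x)) = integral {0..2*pi} g"
proof -
  define h where "h x = g (- x)" for x
  have cont_h: "continuous_on UNIV h"
    unfolding h_def by (intro continuous_on_compose2[OF cont] continuous_intros) auto
  have per_h: "h (x + 2*pi) = h x" for x
    using per[of "- x - 2*pi"] by (simp add: h_def)
  have "integral {0..2*pi} (\<lambda>x. g (t - x)) = integral {0..2*pi} (\<lambda>x. h (x + (2*pi - t)))"
    using per_h[of "_ - t"] by (intro arg_cong[of _ _ "integral _"] ext) (simp add: h_def algebra_simps)
  also have "\<dots> = integral {0..2*pi} h"
    using integral_period_shift[OF cont_h per_h, of "2*pi - t"] t by simp
  also have "\<dots> = integral {- (2*pi)..0} g"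
    unfolding h_def using Henstock_Kurzweil_Integration.integral_reflect_real[of 0 "- (2*pi)" g]
    by simp
  also have "\<dots> = integral {0..2*pi} g"
    using integral_shift_real_ivl[of 0 "2*pi" "2*pi" g] per by simp
  finally show ?thesis .
qed

lemma orthonormal_complement_expansion:
  assumes b: "norm b = 1" and e: "orthonormal_complement_basis b e1 e2" and x: "orthogonal b x"
  shows "x = (x \<bullet> e1) *\<^sub>R e1 + (x \<bullet> e2) *\<^sub>R e2"
proof -
  have in0: "e1 \<bullet> e1 = 1" "e2 \<bullet> e2 = 1" "e1 \<bullet> e2 = 0" "e2 \<bullet> e1 = 0"
    "b \<bullet> b = 1" "b \<bullet> e1 = 0" "b \<bullet> e2 = 0" "e1 \<bullet> b = 0" "e2 \<bullet> b = 0" "x \<bullet> b = 0" "b \<bullet> x = 0"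
    using assms by (auto simp: orthonormal_complement_basis_def orthogonal_def norm_eq_1 inner_commute)
  have ne: "b \<noteq> e1" "b \<noteq> e2" "e1 \<noteq> e2" "0 \<notin> {b, e1, e2}"
    using in0 by auto
  have "pairwise orthogonal {b, e1, e2}"
    using in0 by (auto simp: pairwise_def orthogonal_def)
  then have "independent {b, e1, e2}"
    using ne by (rule_tac pairwise_orthogonal_independent) auto
  moreover have "card {b, e1, e2} = DIM(real^3)"
    using ne by simp
  ultimately have span: "span {b, e1, e2} = UNIV"
    by (metis card_eq_dim dim_UNIV finite.emptyI finite_insert subset_UNIV top.extremum_uniqueI)
  define d where "d = x - ((x \<bullet> e1) *\<^sub>R e1 + (x \<bullet> e2) *\<^sub>R e2)"
  have "orthogonal d y" if "y \<in> {b, e1, e2}" for y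
    using that in0 by (auto simp: d_def orthogonal_def inner_diff_left inner_add_left)
  then have "orthogonal d d"
    using orthogonal_to_span[of d "{b, e1, e2}" d] span by simp
  then show ?thesis
    by (simp add: orthogonal_self d_def)
qed

lemma sphere_delta_integral_basis_independent:
  assumes \<phi>: "continuous_on (sphere 0 1) \<phi>" and b: "norm b = 1" and s: "s \<in> {-1..1}"
    and e: "orthonormal_complement_basis b e1 e2" and e': "orthonormal_complement_basis b e1' e2'"
  shows "sphere_delta_integral \<phi> b e1' e2' s = sphere_delta_integral \<phi> b e1 e2 s"
proof -
  define w where "w = sqrt (1 - s\<^sup>2)"
  define g where "g \<theta> = \<phi> (s *\<^sub>R b + w *\<^sub>R (cos \<theta> *\<^sub>R e1 + sin \<theta> *\<^sub>R e2))" for \<theta>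
  define g' where "g' \<theta> = \<phi> (s *\<^sub>R b + w *\<^sub>R (cos \<theta> *\<^sub>R e1' + sin \<theta> *\<^sub>R e2'))" for \<theta>
  have w2: "w * w = 1 - s * s"
    using s by (simp add: w_def abs_square_le_1 abs_le_iff flip: power2_eq_square)
  have on_sphere: "s *\<^sub>R b + w *\<^sub>R (cos \<theta> *\<^sub>R a1 + sin \<theta> *\<^sub>R a2) \<in> sphere 0 1"
    if a: "orthonormal_complement_basis b a1 a2" for \<theta> a1 a2
  proof -
    have in0: "a1 \<bullet> a1 = 1" "a2 \<bullet> a2 = 1" "a1 \<bullet> a2 = 0" "a2 \<bullet> a1 = 0"
      "b \<bullet> b = 1" "b \<bullet> a1 = 0" "b \<bullet> a2 = 0" "a1 \<bullet> b = 0" "a2 \<bullet> b = 0"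
      using a b by (auto simp: orthonormal_complement_basis_def orthogonal_def norm_eq_1 inner_commute)
    have "s * s + (w * (w * (cos \<theta> * cos \<theta>)) + w * (w * (sin \<theta> * sin \<theta>))) = 1"
      unfolding distrib_left[symmetric] sin_cos_squared_add3 mult_1_right using w2 by simp
    then show ?thesis
      by (simp add: norm_eq_1 inner_add_left inner_add_right in0 algebra_simps)
  qed
  have cont_circle: "continuous_on UNIV
      (\<lambda>\<theta>. \<phi> (s *\<^sub>R b + w *\<^sub>R (cos \<theta> *\<^sub>R a1 + sin \<theta> *\<^sub>R a2)))"
    if "orthonormal_complement_basis b a1 a2" for a1 a2
    by (rule continuous_on_compose2[OF \<phi>]) (use on_sphere[OF that] in \<open>auto intro!: continuous_intros\<close>)
  have cont: "continuous_on UNIV g" "continuous_on UNIV g'"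
    unfolding g_def g'_def using cont_circle e e' by auto
  have per: "g (\<theta> + 2*pi) = g \<theta>" for \<theta>
    by (simp add: g_def)
  have lint: "(LINT \<theta>:{0..2*pi}|lborel. h \<theta>) = integral {0..2*pi} h"
    if "continuous_on UNIV h" for h :: "real \<Rightarrow> real"
    by (intro set_borel_integral_eq_integral borel_integrable_atLeastAtMost')
      (meson that continuous_on_subset subset_UNIV)
  define c d p q where "c = e1' \<bullet> e1" "d = e1' \<bullet> e2" "p = e2' \<bullet> e1" "q = e2' \<bullet> e2"
  have e1': "e1' = c *\<^sub>R e1 + d *\<^sub>R e2" and e2': "e2' = p *\<^sub>R e1 + q *\<^sub>R e2"
    using orthonormal_complement_expansion[OF b e] e'
    unfolding orthonormal_complement_basis_def c_d_p_q_def by blast+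
  have in0: "e1 \<bullet> e1 = 1" "e2 \<bullet> e2 = 1" "e1 \<bullet> e2 = 0" "e2 \<bullet> e1 = 0"
    using e by (auto simp: orthonormal_complement_basis_def orthogonal_def norm_eq_1 inner_commute)
  have "e1' \<bullet> e1' = 1" "e2' \<bullet> e2' = 1" "e1' \<bullet> e2' = 0"
    using e' by (auto simp: orthonormal_complement_basis_def orthogonal_def norm_eq_1)
  then have cd: "c * c + d * d = 1" and pq: "p * p + q * q = 1" and cp: "c * p + d * q = 0"
    unfolding e1' e2' by (simp_all add: inner_add_left inner_add_right in0 algebra_simps)
  define \<sigma> where "\<sigma> = c * q - d * p"
  have "p - - \<sigma> * d = p * (1 - (c * c + d * d)) + c * (c * p + d * q)"
    "q - \<sigma> * c = q * (1 - (c * c + d * d)) + d * (c * p + d * q)"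
    by (simp_all add: \<sigma>_def algebra_simps)
  then have p: "p = - \<sigma> * d" and q: "q = \<sigma> * c"
    by (simp_all add: cd cp)
  have "\<sigma> * \<sigma> * (c * c + d * d) = p * p + q * q"
    by (simp add: p q algebra_simps)
  then have "\<sigma> * \<sigma> = 1"
    by (simp add: cd pq)
  then consider "\<sigma> = 1" | "\<sigma> = - 1"
    by (auto simp: square_eq_1_iff)
  note \<sigma> = this
  obtain t where t: "0 \<le> t" "t \<le> 2*pi" "c = cos t" "d = sin t"
    using sincos_total_2pi_le[of c d] cd unfolding power2_eq_square by blast
  have "integral {0..2*pi} g' = integral {0..2*pi} g"
    using \<sigma>
  proof cases
    case 1
    have "g' \<theta> = g (\<theta> + t)" for \<theta>
      unfolding g'_def g_def e1' e2' p q 1 t(3,4)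
      by (simp add: cos_add sin_add algebra_simps)
    then show ?thesis
      using integral_period_shift[OF cont(1) per t(1,2)] by presburger
  next
    case 2
    have "g' \<theta> = g (t - \<theta>)" for \<theta>
      unfolding g'_def g_def e1' e2' p q 2 t(3,4)
      by (simp add: cos_diff sin_diff algebra_simps)
    then show ?thesis
      using integral_period_reflect_shift[OF cont(1) per t(1,2)] by presburger
  qed
  then show ?thesis
    using lint[OF cont(1)] lint[OF cont(2)]
    unfolding sphere_delta_integral_def g_def g'_def w_def by simp
qed

corollary conical_radon_basis_independent:
  assumes "continuous_on (sphere 0 1) (weighted_ray_integral f u)" and "s \<in> {-1..1}"
    and "orthonormal_complement_basis (cone_axis \<beta>) e1 e2"
  shows "conical_radon f u \<beta> s =
    sphere_delta_integral (weighted_ray_integral f u) (cone_axis \<beta>) e1 e2 s"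
  unfolding conical_radon_def
  using sphere_delta_integral_basis_independent[OF assms(1) norm_cone_axis assms(2,3)
      orthonormal_complement_basis_cone_axis] .

end

theory Submission
  imports Defs
begin

text \<open>
  For a fixed vertex \<open>u\<close>, write \<open>v = x - (u, 0, 0)\<close> and \<open>\<alpha> = v / |v|\<close>. Integrating \<open>s\<^sup>k Cf(u, \<beta>, s)\<close>
  over \<open>s\<close> gives the volume integral of \<open>f |v|\<^sup>-\<^sup>1 (\<alpha> \<bullet> \<beta>)\<^sup>k\<close>. Its vanishing for all \<open>\<beta>\<close> and \<open>k\<close> means
  that all moments of \<open>f |v|\<^sup>-\<^sup>1\<close> in \<open>(\<alpha>\<^sub>1, \<alpha>\<^sub>3)\<close> vanish. On the support of \<open>f\<close> one has
  \<open>\<alpha>\<^sub>2 = sqrt (1 - \<alpha>\<^sub>1\<^sup>2 - \<alpha>\<^sub>3\<^sup>2) > 0\<close>, so by Stone--Weierstrass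
  the integral of \<open>f |v|\<^sup>-\<^sup>1 h(\<alpha>)\<close> vanishes for every continuous \<open>h\<close>.
  The choice \<open>h(\<alpha>) = \<alpha>\<^sub>3\<^sup>-\<^sup>1 (\<alpha>\<^sub>2 / \<alpha>\<^sub>3)\<^sup>m (\<alpha>\<^sub>1 / \<alpha>\<^sub>3)\<^sup>k\<close> removes the factor \<open>|v|\<^sup>-\<^sup>1\<close> and leaves
  a polynomial in \<open>u\<close> with infinitely many zeros. Its coefficients are moments of \<open>f / x\<^sub>3\<close>
  in the projective coordinates \<open>(x\<^sub>1 / x\<^sub>3, x\<^sub>2 / x\<^sub>3, 1 / x\<^sub>3)\<close>, which are injective on the support
  of \<open>f\<close>, so a second application of Stone--Weierstrass yields that the integral of \<open>f\<^sup>2\<close> is zero.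
\<close>

section \<open>Moments of compactly supported weights\<close>

lemma set_integrable_compact_lborel:
  fixes g :: "'a::euclidean_space \<Rightarrow> real"
  assumes "compact K" "continuous_on K g"
  shows "set_integrable lborel K g"
  using borel_integrable_compact[OF assms] by (simp add: set_integrable_def)

text \<open>By the binomial theorem the integral is a polynomial in \<open>t\<close> of degree at
  most \<open>k\<close>. Its infinitely many zeros kill every coefficient, and
  \<open>k choose i\<close> is nonzero. The parameter will be the tangent of the axis angle first
  and the vertex position later.\<close>

lemma moment_expansion:
  fixes w p q :: "'a::euclidean_space \<Rightarrow> real"
  assumes K: "compact K" and cont: "continuous_on K w" "continuous_on K p" "continuous_on K q"
    and inf: "infinite T"
    and zero: "\<And>t. t \<in> T \<Longrightarrow> (LINT x:K|lborel. w x * (p x + t * q x) ^ k) = 0"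
    and i: "i \<le> k"
  shows "(LINT x:K|lborel. w x * p x ^ (k - i) * q x ^ i) = 0"
proof -
  define c where "c j = (k choose j) * (LINT x:K|lborel. w x * p x ^ (k - j) * q x ^ j)" for j
  have "(\<Sum>j\<le>k. c j * t ^ j) = 0" if "t \<in> T" for t
  proof -
    have binom: "w x * (p x + t * q x) ^ k =
      (\<Sum>j\<le>k. (k choose j) * t ^ j * (w x * p x ^ (k - j) * q x ^ j))" for x
      unfolding add.commute[of "p x"] binomial_ring sum_distrib_left
      by (intro sum.cong) (simp_all add: power_mult_distrib)
    have "(LINT x:K|lborel. w x * (p x + t * q x) ^ k) =
      (LINT x:K|lborel. \<Sum>j\<le>k. (k choose j) * t ^ j * (w x * p x ^ (k - j) * q x ^ j))"
      by (simp only: binom)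
    also have "\<dots> = (\<Sum>j\<le>k. LINT x:K|lborel. (k choose j) * t ^ j * (w x * p x ^ (k - j) * q x ^ j))"
      unfolding set_lebesgue_integral_def scaleR_sum_right
      by (intro Bochner_Integration.integral_sum borel_integrable_compact K continuous_intros cont)
    also have "\<dots> = (\<Sum>j\<le>k. c j * t ^ j)"
      by (intro sum.cong refl) (simp add: c_def)
    finally show ?thesis using zero[OF that] by simp
  qed
  then have "T \<subseteq> {t. (\<Sum>j\<le>k. c j * t ^ j) = 0}"
    by blast
  then have "infinite {t. (\<Sum>j\<le>k. c j * t ^ j) = 0}"
    using inf infinite_super by blast
  then have "c i = 0"
    using polyfun_finite_roots[of c k] i by blast
  then show ?thesis
    using i by (simp add: c_def)
qed

text \<open>Vanishing monomial moments give vanishing integrals against all polynomials in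
  \<open>T\<close>. Uniform approximation of \<open>h\<close> on the compact image of
  \<open>K\<close> then costs at most \<open>e\<close> times the L1 norm of \<open>w\<close>.
  \<open>T\<close> may fail to be injective, so only functions that factor through \<open>T\<close>
  are reached.\<close>

lemma integral_weighted_moments_eq_zero:
  fixes T :: "'a::euclidean_space \<Rightarrow> 'b::euclidean_space"
  assumes K: "compact K" and w: "continuous_on K w" and T: "continuous_on K T"
    and mom: "\<And>n. (LINT x:K|lborel. w x * (\<Prod>b\<in>Basis. (T x \<bullet> b) ^ n b)) = 0"
    and h: "continuous_on (T ` K) h"
  shows "(LINT x:K|lborel. w x * h (T x)) = 0"
proof -
  \<comment> \<open>\<open>N\<close> is closed under multiplication by polynomials in \<open>T\<close>, while the weights with vanishing
    mean alone are not.\<close>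
  define N where "N = {g. continuous_on K g \<and>
     (\<forall>n. (LINT x:K|lborel. g x * (\<Prod>b\<in>Basis. (T x \<bullet> b) ^ n b)) = 0)}"
  note int = set_integrable_compact_lborel[OF K]
  have add: "(\<lambda>x. g x + g' x) \<in> N" if "g \<in> N" "g' \<in> N" for g g'
  proof -
    have "(LINT x:K|lborel. (g x + g' x) * (\<Prod>b\<in>Basis. (T x \<bullet> b) ^ n b)) = 0" for n
      unfolding distrib_right using that
      by (subst set_integral_add) (auto simp: N_def intro!: int continuous_intros T)
    then show ?thesis using that by (auto simp: N_def intro!: continuous_intros)
  qed
  have scale: "(\<lambda>x. c * g x) \<in> N" if "g \<in> N" for g c
    using that by (simp add: N_def mult.assoc continuous_on_mult_left)
  have coord: "(\<lambda>x. (T x \<bullet> b) * g x) \<in> N" if "g \<in> N" "b \<in> Basis" for g b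
  proof -
    have "(LINT x:K|lborel. (T x \<bullet> b) * g x * (\<Prod>b\<in>Basis. (T x \<bullet> b) ^ n b)) = 0" for n
    proof -
      have "(T x \<bullet> b) * g x * (\<Prod>b\<in>Basis. (T x \<bullet> b) ^ n b) =
        g x * (\<Prod>b'\<in>Basis. (T x \<bullet> b') ^ (n(b := Suc (n b))) b')" for x
      proof -
        have "(\<Prod>b'\<in>Basis - {b}. (T x \<bullet> b') ^ (n(b := Suc (n b))) b') = (\<Prod>b'\<in>Basis - {b}. (T x \<bullet> b') ^ n b')"
          by (intro prod.cong) auto
        then show ?thesis
          using that(2) by (simp add: prod.remove[of Basis b])
      qed
      then show ?thesis using that(1) by (simp only: N_def mem_Collect_eq)
    qed
    then show ?thesis using that by (auto simp: N_def intro!: continuous_intros T)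
  qed
  have sum: "(\<lambda>x. \<Sum>b\<in>B. c b * ((T x \<bullet> b) * g x)) \<in> N" if "g \<in> N" "B \<subseteq> Basis" for g c B
    using finite_subset[OF that(2) finite_Basis] that(2)
  proof (induction B)
    case empty
    then show ?case by (simp add: N_def)
  next
    case (insert b B)
    then show ?case by (simp add: add scale coord that(1))
  qed
  have poly: "(\<lambda>x. r (T x) * g x) \<in> N" if "real_polynomial_function r" "g \<in> N" for r g
    using that
  proof (induction arbitrary: g)
    case (linear r)
    have "r y = (\<Sum>b\<in>Basis. r b * (y \<bullet> b))" for y
    proof -
      have "r y = r (\<Sum>b\<in>Basis. (y \<bullet> b) *\<^sub>R b)" by (simp add: euclidean_representation)
      also have "\<dots> = (\<Sum>b\<in>Basis. r b * (y \<bullet> b))"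
        using linear(1) by (simp add: linear_sum[OF bounded_linear.linear] linear_cmul[OF bounded_linear.linear] mult.commute)
      finally show ?thesis .
    qed
    from this[of "T _"] have "(\<lambda>x. r (T x) * g x) = (\<lambda>x. \<Sum>b\<in>Basis. r b * ((T x \<bullet> b) * g x))"
      by (simp add: sum_distrib_right mult.assoc)
    then show ?case using sum[OF linear(2) order_refl] by simp
  next
    case (mult r r')
    from mult.IH(1)[OF mult.IH(2)[OF mult.prems]] show ?case by (simp add: mult.assoc)
  qed (simp_all add: scale add distrib_right)
  have "w \<in> N" using w mom by (simp add: N_def)
  have poly0: "(LINT x:K|lborel. w x * r (T x)) = 0" if "real_polynomial_function r" for r
  proof -
    \<comment> \<open>The zero exponent turns membership in \<open>N\<close> into vanishing of the
      plain integral.\<close>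
    have "(LINT x:K|lborel. r (T x) * w x * (\<Prod>b\<in>Basis. (T x \<bullet> b) ^ (\<lambda>_. 0) b)) = 0"
      using poly[OF that \<open>w \<in> N\<close>] unfolding N_def mem_Collect_eq by (elim conjE allE)
    then show ?thesis by (simp add: mult.commute)
  qed
  define I where "I = (LINT x:K|lborel. \<bar>w x\<bar>)"
  have "\<bar>LINT x:K|lborel. w x * h (T x)\<bar> \<le> e * I" if e: "e > 0" for e
  proof -
    obtain r where r: "real_polynomial_function r" "\<And>y. y \<in> T ` K \<Longrightarrow> \<bar>h y - r y\<bar> < e"
      using Stone_Weierstrass_real_polynomial_function[OF compact_continuous_image[OF T K] h e] by blast
    have contr: "continuous_on K (\<lambda>x. r (T x))"
      by (rule continuous_on_compose2[OF _ T subset_UNIV])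
        (simp add: r(1) continuous_at_imp_continuous_on continuous_real_polymonial_function)
    have conth: "continuous_on K (\<lambda>x. h (T x))"
      by (rule continuous_on_compose2[OF h T]) auto
    have "(LINT x:K|lborel. w x * h (T x)) = (LINT x:K|lborel. w x * h (T x)) - (LINT x:K|lborel. w x * r (T x))"
      using poly0[OF r(1)] by simp
    also have "\<dots> = (LINT x:K|lborel. w x * (h (T x) - r (T x)))"
      unfolding right_diff_distrib
      by (subst set_integral_diff) (auto intro!: int continuous_intros w contr conth)
    also have "\<bar>\<dots>\<bar> \<le> (LINT x:K|lborel. \<bar>w x * (h (T x) - r (T x))\<bar>)"
      by (intro set_integral_norm_bound[OF int, unfolded real_norm_def] continuous_intros w contr conth)
    also have "\<dots> \<le> (LINT x:K|lborel. e * \<bar>w x\<bar>)"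
      by (intro set_integral_mono int continuous_intros w contr conth)
        (use r(2) in \<open>force simp: abs_mult mult.commute[of e] intro: mult_left_mono less_imp_le\<close>)
    also have "\<dots> = e * I"
      by (simp add: I_def)
    finally show ?thesis .
  qed note bound = this
  have "I \<ge> 0" unfolding I_def set_lebesgue_integral_def by simp
  have "\<bar>LINT x:K|lborel. w x * h (T x)\<bar> \<le> 0"
  proof (rule field_le_epsilon)
    fix e :: real assume "e > 0"
    \<comment> \<open>Dividing by \<open>I + 1\<close> rather than \<open>I\<close> covers the case
      \<open>I = 0\<close>.\<close>
    have "\<bar>LINT x:K|lborel. w x * h (T x)\<bar> \<le> e / (I + 1) * I"
      using \<open>e > 0\<close> \<open>I \<ge> 0\<close> by (intro bound) auto
    also have "\<dots> \<le> 0 + e" using \<open>e > 0\<close> \<open>I \<ge> 0\<close> by (simp add: field_simps)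
    finally show "\<bar>LINT x:K|lborel. w x * h (T x)\<bar> \<le> 0 + e" .
  qed
  then show ?thesis by simp
qed

section \<open>Polar coordinates about the axis of the cone\<close>

text \<open>The integrand is regarded as a map into \<open>real^1\<close>, where the vector-valued
  formulas apply, and its only component is read off afterwards.\<close>

lemma change_of_variables_real:
  fixes F :: "real^'m::{finite,wellorder} \<Rightarrow> real" and g :: "real^'m::_ \<Rightarrow> real^'m::_"
  assumes S: "S \<in> sets lebesgue"
    and der: "\<And>x. x \<in> S \<Longrightarrow> (g has_derivative g' x) (at x within S)"
    and inj: "inj_on g S"
    and F: "F absolutely_integrable_on g ` S"
  shows "(\<lambda>x. \<bar>det (matrix (g' x))\<bar> * F (g x)) absolutely_integrable_on S"
    and "integral S (\<lambda>x. \<bar>det (matrix (g' x))\<bar> * F (g x)) = integral (g ` S) F"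
proof -
  let ?F = "\<lambda>x. vec (F x) :: real^1"
  let ?G = "\<lambda>x. \<bar>det (matrix (g' x))\<bar> *\<^sub>R ?F (g x)"
  have F1: "?F absolutely_integrable_on g ` S"
    using F by (simp add: absolutely_integrable_componentwise_iff[where f="?F"] Basis_vec_def inner_axis)
  note * = absolutely_integrable_change_of_variables[OF S der inj, of ?F]
    integral_change_of_variables[OF S der inj disjI1[OF F1]]
  have G: "?G absolutely_integrable_on S"
    using * F1 by simp
  then show "(\<lambda>x. \<bar>det (matrix (g' x))\<bar> * F (g x)) absolutely_integrable_on S"
    by (simp add: absolutely_integrable_componentwise_iff[where f="?G"] Basis_vec_def inner_axis)
  have "integral S (\<lambda>x. ?G x $ 1) = integral S ?G $ 1"
    using G by (intro integral_component_eq_cart) (simp add: absolutely_integrable_on_def)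
  also have "\<dots> = integral (g ` S) ?F $ 1"
    using * by simp
  also have "\<dots> = integral (g ` S) (\<lambda>x. ?F x $ 1)"
    using F1 by (intro integral_component_eq_cart[symmetric]) (simp add: absolutely_integrable_on_def)
  finally show "integral S (\<lambda>x. \<bar>det (matrix (g' x))\<bar> * F (g x)) = integral (g ` S) F"
    by simp
qed

text \<open>Both measures agree on boxes. The order \<open>(s, t, r)\<close> is chosen for Fubini:
  \<open>s\<close> outermost, then the angle, then the radius, which is the nesting of the integrals
  in \<open>conical_radon\<close>.\<close>

lemma lborel_vec3: "lborel = distr lborel borel (\<lambda>(s, t, r). vector [r, s, t] :: real^3)"
proof (rule lborel_eqI)
  let ?\<phi> = "\<lambda>(s, t, r). vector [r, s, t] :: real^3"
  have \<phi>: "?\<phi> = (\<lambda>p. fst p *\<^sub>R axis 2 1 + fst (snd p) *\<^sub>R axis 3 1 + snd (snd p) *\<^sub>R axis 1 1)"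
    by (auto simp: fun_eq_iff vec_eq_iff forall_3 axis_def)
  have meas: "?\<phi> \<in> borel_measurable borel"
    unfolding \<phi> by (intro borel_measurable_continuous_onI continuous_intros)
  fix l m :: "real^3" assume lm: "\<And>b. b \<in> Basis \<Longrightarrow> l \<bullet> b \<le> m \<bullet> b"
  have le: "l $ i \<le> m $ i" for i
  proof -
    have "axis i 1 \<in> (Basis :: (real^3) set)"
      by (auto simp: Basis_vec_def)
    from lm[OF this] show ?thesis
      by (simp add: inner_axis)
  qed
  have B: "(Basis :: (real^3) set) = {axis 1 1, axis 2 1, axis 3 1}"
    by (auto simp: Basis_vec_def UNIV_3)
  have ne: "axis 1 1 \<noteq> (axis 2 1 :: real^3)" "axis 1 1 \<noteq> (axis 3 1 :: real^3)" "axis 2 1 \<noteq> (axis 3 1 :: real^3)"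
    by (simp_all add: axis_eq_axis)
  have "?\<phi> -` box l m = {l$2<..<m$2} \<times> {l$3<..<m$3} \<times> {l$1<..<m$1}"
    by (auto simp: mem_box_cart forall_3)
  then have "emeasure (distr lborel borel ?\<phi>) (box l m) =
      emeasure (lborel \<Otimes>\<^sub>M (lborel \<Otimes>\<^sub>M lborel)) ({l$2<..<m$2} \<times> {l$3<..<m$3} \<times> {l$1<..<m$1})"
    using meas by (subst emeasure_distr) (simp_all add: lborel_prod)
  also have "\<dots> = ennreal ((m$2 - l$2) * ((m$3 - l$3) * (m$1 - l$1)))"
  proof -
    have "emeasure lborel ({l$3<..<m$3} \<times> {l$1<..<m$1}) = ennreal ((m$3 - l$3) * (m$1 - l$1))"
      using lborel.emeasure_pair_measure_Times[of "{l$3<..<m$3}" lborel "{l$1<..<m$1}"] le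
      by (simp add: lborel_prod ennreal_mult'')
    then show ?thesis
      using lborel.emeasure_pair_measure_Times[of "{l$2<..<m$2}" lborel "{l$3<..<m$3} \<times> {l$1<..<m$1}"] le
      by (simp add: lborel_prod ennreal_mult'' borel_Times)
  qed
  also have "(m$2 - l$2) * ((m$3 - l$3) * (m$1 - l$1)) = (\<Prod>b\<in>Basis. (m - l) \<bullet> b)"
    unfolding B using ne by (simp add: inner_axis)
  finally show "emeasure (distr lborel borel ?\<phi>) (box l m) = (\<Prod>b\<in>Basis. (m - l) \<bullet> b)" .
qed simp

text \<open>The components of \<open>p\<close> are the radius, the cosine of the angle to the cone
  axis, and the rotation angle about that axis. The frame is the one fixed in
  \<open>conical_radon\<close>.\<close>

definition polar :: "real \<Rightarrow> real \<Rightarrow> real^3 \<Rightarrow> real^3" where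
  "polar u \<beta> p = vector [u, 0, 0] + p$1 *\<^sub>R (p$2 *\<^sub>R vector [cos \<beta>, 0, sin \<beta>] + sqrt (1 - (p$2)\<^sup>2) *\<^sub>R
     (cos (p$3) *\<^sub>R vector [0, 1, 0] + sin (p$3) *\<^sub>R vector [- sin \<beta>, 0, cos \<beta>]))"

definition polar_deriv :: "real \<Rightarrow> real^3 \<Rightarrow> real^3 \<Rightarrow> real^3" where
  "polar_deriv \<beta> p h = h$1 *\<^sub>R (p$2 *\<^sub>R vector [cos \<beta>, 0, sin \<beta>] + sqrt (1 - (p$2)\<^sup>2) *\<^sub>R
     (cos (p$3) *\<^sub>R vector [0, 1, 0] + sin (p$3) *\<^sub>R vector [- sin \<beta>, 0, cos \<beta>])) +
     p$1 *\<^sub>R (h$2 *\<^sub>R vector [cos \<beta>, 0, sin \<beta>] - (p$2 * h$2 / sqrt (1 - (p$2)\<^sup>2)) *\<^sub>R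
     (cos (p$3) *\<^sub>R vector [0, 1, 0] + sin (p$3) *\<^sub>R vector [- sin \<beta>, 0, cos \<beta>]) +
     sqrt (1 - (p$2)\<^sup>2) *\<^sub>R (- (sin (p$3) * h$3) *\<^sub>R vector [0, 1, 0] + (cos (p$3) * h$3) *\<^sub>R vector [- sin \<beta>, 0, cos \<beta>]))"

text \<open>Strict bounds on \<open>p$2\<close> keep the square root differentiable. A positive
  radius and a half-open angle range give injectivity. The sign of the cosine cuts out the
  half-space of positive second coordinate.\<close>

definition polar_domain :: "(real^3) set" where
  "polar_domain = {p. 0 < p$1 \<and> -1 < p$2 \<and> p$2 < 1 \<and> 0 \<le> p$3 \<and> p$3 < 2*pi \<and> 0 < cos (p$3)}"

lemma has_derivative_polar:
  assumes "-1 < p$2" "p$2 < 1"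
  shows "(polar u \<beta> has_derivative polar_deriv \<beta> p) (at p within S)"
proof -
  have pos: "1 - (p$2)\<^sup>2 > 0"
    using assms by (simp add: abs_square_less_1 abs_less_iff)
  \<comment> \<open>The left-hand side is the raw form in which the derivative rules deliver the
    result, with \<open>w\<close> for the square root.\<close>
  have eq: "0 + (r *\<^sub>R (h2 *\<^sub>R b + (w *\<^sub>R ((h3 * - n) *\<^sub>R e1 + (h3 * c) *\<^sub>R e2) +
        ((0 - real 2 * h2 * s ^ (2 - 1)) * (inverse w / 2)) *\<^sub>R m)) + h1 *\<^sub>R q) =
      h1 *\<^sub>R q + r *\<^sub>R (h2 *\<^sub>R b - (s * h2 / w) *\<^sub>R m + w *\<^sub>R (- (n * h3) *\<^sub>R e1 + (c * h3) *\<^sub>R e2))"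
    for r s w n c h1 h2 h3 :: real and b e1 e2 m q :: "real^3"
  proof -
    have "(0 - real 2 * h2 * s ^ (2 - 1)) * (inverse w / 2) = - (s * h2 / w)"
      by (simp add: inverse_eq_divide)
    moreover have "h3 * - n = - (n * h3)" "h3 * c = c * h3"
      by simp_all
    ultimately show ?thesis
      by (simp only: scaleR_minus_left ac_simps add_0 diff_conv_add_uminus)
  qed
  show ?thesis
    unfolding polar_def[abs_def] polar_deriv_def[abs_def]
    apply (rule has_derivative_eq_rhs)
     apply (rule derivative_intros bounded_linear.has_derivative[OF bounded_linear_vec_nth] pos)+
    apply (rule ext, rule eq)
    done
qed

text \<open>Write r for \<open>p$1\<close>. The columns of the Jacobian matrix are orthogonal of
  lengths 1, |r| / w and |r| w, so \<open>w\<close> cancels and the volume factor is r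
  squared.\<close>

lemma det_polar_deriv:
  assumes "-1 < p$2" "p$2 < 1"
  shows "det (matrix (polar_deriv \<beta> p)) = - (p$1)\<^sup>2"
proof -
  define w where "w = sqrt (1 - (p$2)\<^sup>2)"
  have pos: "1 - (p$2)\<^sup>2 > 0"
    using assms by (simp add: abs_square_less_1 abs_less_iff)
  then have w: "w > 0" "w\<^sup>2 = 1 - (p$2)\<^sup>2"
    by (simp_all add: w_def)
  then have w0: "w \<noteq> 0"
    by simp
  \<comment> \<open>The Pythagorean factors stay explicit: in this form the claim is a rational
    identity in the entries, valid for nonzero \<open>w\<close> without any relation between
    \<open>sin\<close>, \<open>cos\<close> and \<open>w\<close>.\<close>
  have "det (matrix (polar_deriv \<beta> p)) =
    - ((p$1)\<^sup>2 * ((cos \<beta>)\<^sup>2 + (sin \<beta>)\<^sup>2) * ((cos (p$3))\<^sup>2 + (sin (p$3))\<^sup>2) * ((p$2)\<^sup>2 + w\<^sup>2))"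
    unfolding det_3 matrix_def polar_deriv_def w_def[symmetric]
    by (simp add: axis_def power2_eq_square w0
          del: sin_cos_squared_add sin_cos_squared_add2 sin_cos_squared_add3)
       (simp add: algebra_simps w0 del: sin_cos_squared_add sin_cos_squared_add2 sin_cos_squared_add3)
  then show ?thesis
    unfolding w(2) by (simp add: power2_eq_square)
qed


lemma polar_components:
  fixes u \<beta> :: real and p :: "real^3"
  defines "v \<equiv> polar u \<beta> p - vector [u, 0, 0]" and "w \<equiv> sqrt (1 - (p$2)\<^sup>2)"
  shows "v \<bullet> vector [cos \<beta>, 0, sin \<beta>] = p$1 * p$2"
    and "v $ 2 = p$1 * (w * cos (p$3))"
    and "v \<bullet> vector [- sin \<beta>, 0, cos \<beta>] = p$1 * (w * sin (p$3))"
proof -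
  have "v \<bullet> vector [cos \<beta>, 0, sin \<beta>] = p$1 * p$2 * ((cos \<beta>)\<^sup>2 + (sin \<beta>)\<^sup>2)"
    unfolding v_def polar_def w_def[symmetric]
    by (simp add: inner_vec_def sum_3 power2_eq_square del: sin_cos_squared_add sin_cos_squared_add2 sin_cos_squared_add3)
      (simp add: algebra_simps del: sin_cos_squared_add sin_cos_squared_add2 sin_cos_squared_add3)
  then show "v \<bullet> vector [cos \<beta>, 0, sin \<beta>] = p$1 * p$2"
    by simp
  show "v $ 2 = p$1 * (w * cos (p$3))"
    by (simp add: v_def polar_def w_def)
  have "v \<bullet> vector [- sin \<beta>, 0, cos \<beta>] = p$1 * (w * sin (p$3)) * ((cos \<beta>)\<^sup>2 + (sin \<beta>)\<^sup>2)"
    unfolding v_def polar_def w_def[symmetric]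
    by (simp add: inner_vec_def sum_3 power2_eq_square del: sin_cos_squared_add sin_cos_squared_add2 sin_cos_squared_add3)
      (simp add: algebra_simps del: sin_cos_squared_add sin_cos_squared_add2 sin_cos_squared_add3)
  then show "v \<bullet> vector [- sin \<beta>, 0, cos \<beta>] = p$1 * (w * sin (p$3))"
    by simp
qed

lemma norm_rotated_coordinates:
  fixes v :: "real^3"
  shows "(norm v)\<^sup>2 = (v \<bullet> vector [cos \<beta>, 0, sin \<beta>])\<^sup>2 + (v $ 2)\<^sup>2 + (v \<bullet> vector [- sin \<beta>, 0, cos \<beta>])\<^sup>2"
proof -
  have "(v \<bullet> vector [cos \<beta>, 0, sin \<beta>])\<^sup>2 + (v $ 2)\<^sup>2 + (v \<bullet> vector [- sin \<beta>, 0, cos \<beta>])\<^sup>2 =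
    (v $ 2)\<^sup>2 + ((v $ 1)\<^sup>2 + (v $ 3)\<^sup>2) * ((cos \<beta>)\<^sup>2 + (sin \<beta>)\<^sup>2)"
    by (simp add: inner_vec_def sum_3 power2_eq_square del: sin_cos_squared_add sin_cos_squared_add2 sin_cos_squared_add3)
      (simp add: algebra_simps del: sin_cos_squared_add sin_cos_squared_add2 sin_cos_squared_add3)
  then show ?thesis
    unfolding power2_norm_eq_inner by (simp add: inner_vec_def sum_3 power2_eq_square)
qed

lemma eq_of_rotated_coordinates:
  fixes x y :: "real^3"
  assumes "x \<bullet> vector [cos \<beta>, 0, sin \<beta>] = y \<bullet> vector [cos \<beta>, 0, sin \<beta>]" "x $ 2 = y $ 2"
    "x \<bullet> vector [- sin \<beta>, 0, cos \<beta>] = y \<bullet> vector [- sin \<beta>, 0, cos \<beta>]"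
  shows "x = y"
  using norm_rotated_coordinates[of "x - y" \<beta>] assms by (simp add: inner_diff_left)

lemma norm_polar:
  assumes "0 \<le> p$1" "-1 \<le> p$2" "p$2 \<le> 1"
  shows "norm (polar u \<beta> p - vector [u, 0, 0]) = p$1"
proof -
  have "0 \<le> 1 - (p$2)\<^sup>2"
    using assms by (simp add: abs_square_le_1 abs_le_iff)
  then have "(norm (polar u \<beta> p - vector [u, 0, 0]))\<^sup>2 =
      (p$1)\<^sup>2 * ((p$2)\<^sup>2 + (1 - (p$2)\<^sup>2) * ((cos (p$3))\<^sup>2 + (sin (p$3))\<^sup>2))"
    unfolding norm_rotated_coordinates[of _ \<beta>] polar_components
    by (simp only: power_mult_distrib real_sqrt_pow2) (simp only: algebra_simps)
  then have "(norm (polar u \<beta> p - vector [u, 0, 0]))\<^sup>2 = (p$1)\<^sup>2"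
    by simp
  then show ?thesis
    using assms(1) by (simp add: power2_eq_iff_nonneg)
qed

text \<open>The norm determines the radius, the component along the axis then determines
  \<open>p$2\<close>, and the two orthogonal components determine the angle modulo
  \<open>2*pi\<close>.\<close>

lemma inj_on_polar: "inj_on (polar u \<beta>) polar_domain"
proof (rule inj_onI)
  fix p p' assume p: "p \<in> polar_domain" and p': "p' \<in> polar_domain" and eq: "polar u \<beta> p = polar u \<beta> p'"
  have 1: "p$1 = p'$1"
    using norm_polar[of p u \<beta>] norm_polar[of p' u \<beta>] p p' eq by (simp add: polar_domain_def)
  have pos: "p$1 > 0" "p'$1 > 0"
    using p p' by (simp_all add: polar_domain_def)
  have 2: "p$2 = p'$2"
    using polar_components(1)[of u \<beta> p] polar_components(1)[of u \<beta> p'] eq 1 pos by simp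
  have "1 - (p$2)\<^sup>2 > 0"
    using p by (simp add: polar_domain_def abs_square_less_1 abs_less_iff)
  then have "cos (p$3) = cos (p'$3)" "sin (p$3) = sin (p'$3)"
    using polar_components(2,3)[of u \<beta> p] polar_components(2,3)[of u \<beta> p'] eq 1 2 pos by simp_all
  then obtain n :: int where n: "p$3 = p'$3 + 2 * pi * n"
    using sin_cos_eq_iff[of "p$3" "p'$3"] by auto
  have "\<bar>p$3 - p'$3\<bar> < 2 * pi"
    using p p' by (auto simp: polar_domain_def abs_less_iff)
  then have "\<bar>real_of_int n\<bar> < 1"
    using n by (simp add: abs_mult)
  then have "n = 0" by linarith
  then show "p = p'"
    using 1 2 n by (simp add: vec_eq_iff forall_3)
qed

text \<open>The second coordinate of an image point is the radius times
  \<open>sqrt (1 - (p$2)\<^sup>2) * cos (p$3)\<close>, which explains the half-space. Conversely,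
  \<open>a\<close>, \<open>b\<close>, \<open>c\<close> are coordinates in the rotated frame, from
  which the parameters are recovered.\<close>

lemma image_polar: "polar u \<beta> ` polar_domain = {x. 0 < x $ 2}"
proof (intro equalityI subsetI)
  fix x assume "x \<in> polar u \<beta> ` polar_domain"
  then obtain p where p: "p \<in> polar_domain" and x: "x = polar u \<beta> p" by blast
  have "1 - (p$2)\<^sup>2 > 0"
    using p by (simp add: polar_domain_def abs_square_less_1 abs_less_iff)
  then show "x \<in> {x. 0 < x $ 2}"
    using polar_components(2)[of u \<beta> p] p x by (simp add: polar_domain_def)
next
  fix x :: "real^3" assume "x \<in> {x. 0 < x $ 2}"
  then have x: "0 < x $ 2" by simp
  define v where "v = x - vector [u, 0, 0]"
  define a where "a = v \<bullet> vector [cos \<beta>, 0, sin \<beta>]"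
  define b where "b = v $ 2"
  define c where "c = v \<bullet> vector [- sin \<beta>, 0, cos \<beta>]"
  define r where "r = norm v"
  define w where "w = sqrt (1 - (a / r)\<^sup>2)"
  have b: "b > 0"
    using x by (simp add: b_def v_def)
  then have r: "r > 0"
    by (auto simp: r_def b_def)
  have r2: "r\<^sup>2 = a\<^sup>2 + b\<^sup>2 + c\<^sup>2"
    unfolding r_def a_def b_def c_def by (rule norm_rotated_coordinates)
  have w2: "1 - (a / r)\<^sup>2 = (b\<^sup>2 + c\<^sup>2) / r\<^sup>2"
  proof -
    have "b\<^sup>2 + c\<^sup>2 = r\<^sup>2 - a\<^sup>2" using r2 by simp
    then show ?thesis using r by (simp add: power_divide diff_divide_distrib)
  qed
  \<comment> \<open>A positive \<open>b\<close> keeps the point off the cone axis, so that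
    \<open>w\<close> is nonzero and the angle is well defined.\<close>
  have bc: "b\<^sup>2 + c\<^sup>2 > 0"
    using b by (simp add: add_pos_nonneg)
  have pos: "1 - (a / r)\<^sup>2 > 0"
    unfolding w2 using bc r by simp
  have w: "w > 0" "(r * w)\<^sup>2 = b\<^sup>2 + c\<^sup>2"
    using pos r by (simp_all add: w_def power_mult_distrib w2)
  have "(b / (r * w))\<^sup>2 + (c / (r * w))\<^sup>2 = 1"
    unfolding power_divide w(2) using bc b by (simp flip: add_divide_distrib)
  then obtain t where t: "0 \<le> t" "t < 2*pi" "b / (r * w) = cos t" "c / (r * w) = sin t"
    by (rule sincos_total_2pi)
  define p :: "real^3" where "p = vector [r, a / r, t]"
  have "(a / r)\<^sup>2 < 1" using pos by simp
  then have s: "-1 < a / r" "a / r < 1"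
    using abs_square_less_1[of "a / r"] by (simp_all only: abs_less_iff) linarith+
  have "0 < cos t"
    using b r w t(3) by (metis divide_pos_pos mult_pos_pos)
  then have "p \<in> polar_domain"
    using s r t by (simp add: polar_domain_def p_def)
  moreover have "x = polar u \<beta> p"
  proof -
    have "v = polar u \<beta> p - vector [u, 0, 0]"
    proof (rule eq_of_rotated_coordinates)
      show "v \<bullet> vector [cos \<beta>, 0, sin \<beta>] = (polar u \<beta> p - vector [u, 0, 0]) \<bullet> vector [cos \<beta>, 0, sin \<beta>]"
        using r unfolding polar_components a_def[symmetric] by (simp add: p_def)
      show "v $ 2 = (polar u \<beta> p - vector [u, 0, 0]) $ 2"
        using r w unfolding polar_components b_def[symmetric] by (simp add: p_def t(3)[symmetric] flip: w_def)
      show "v \<bullet> vector [- sin \<beta>, 0, cos \<beta>] = (polar u \<beta> p - vector [u, 0, 0]) \<bullet> vector [- sin \<beta>, 0, cos \<beta>]"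
        using r w unfolding polar_components c_def[symmetric] by (simp add: p_def t(4)[symmetric] flip: w_def)
    qed
    then show ?thesis by (simp add: v_def)
  qed
  ultimately show "x \<in> polar u \<beta> ` polar_domain" by blast
qed

section \<open>Moments of the conical Radon transform\<close>

lemma set_lborel_integral_eq_integral:
  fixes F :: "'a::euclidean_space \<Rightarrow> real"
  assumes "\<And>x. x \<notin> K \<Longrightarrow> F x = 0"
  shows "(LINT x:K|lborel. F x) = (LINT x|lborel. F x)"
  unfolding set_lebesgue_integral_def
  by (intro Bochner_Integration.integral_cong) (use assms in \<open>auto simp: indicator_def\<close>)

text \<open>Since \<open>F\<close> lives in the half-space covered by \<open>polar\<close>, nothing
  is lost on \<open>polar_domain\<close>. The change of variables takes place in
  \<open>lebesgue\<close>; Borel measurability of \<open>H\<close> carries the result back to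
  \<open>lborel\<close>.\<close>

lemma polar_pullback:
  fixes F :: "real^3 \<Rightarrow> real" and u \<beta> :: real
  assumes F: "integrable lborel F" and supp: "\<And>x. F x \<noteq> 0 \<Longrightarrow> 0 < x $ 2"
  defines "H \<equiv> \<lambda>p. indicator polar_domain p * ((p$1)\<^sup>2 * F (polar u \<beta> p))"
  assumes meas: "H \<in> borel_measurable borel"
  shows "integrable lborel H" and "(LINT p|lborel. H p) = (LINT x|lborel. F x)"
proof -
  have S: "polar_domain \<in> sets borel"
  proof -
    have "polar_domain = {p. 0 < p$1} \<inter> {p. -1 < p$2} \<inter> {p. p$2 < 1} \<inter> {p. 0 \<le> p$3} \<inter> {p. p$3 < 2*pi} \<inter> {p. 0 < cos (p$3)}"
      by (auto simp: polar_domain_def)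
    also have "\<dots> \<in> sets borel"
      by (intro sets.Int borel_open borel_closed open_Collect_less closed_Collect_le continuous_intros)
    finally show ?thesis .
  qed
  then have S': "polar_domain \<in> sets lebesgue"
    by simp
  have F1: "F absolutely_integrable_on UNIV"
    using F by (simp add: set_integrable_def integrable_completion)
  have F2: "F absolutely_integrable_on polar u \<beta> ` polar_domain"
    unfolding image_polar
    by (rule set_integrable_subset[OF F1]) (auto intro!: borel_open open_Collect_less continuous_intros)
  have der: "(polar u \<beta> has_derivative polar_deriv \<beta> p) (at p within polar_domain)" if "p \<in> polar_domain" for p
    using that by (intro has_derivative_polar) (auto simp: polar_domain_def)
  have det: "\<bar>det (matrix (polar_deriv \<beta> p))\<bar> = (p$1)\<^sup>2" if "p \<in> polar_domain" for p
    using that by (subst det_polar_deriv) (auto simp: polar_domain_def)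
  note cov = change_of_variables_real[OF S' der inj_on_polar F2]
  have Hdet: "H = (\<lambda>p. indicator polar_domain p *\<^sub>R (\<bar>det (matrix (polar_deriv \<beta> p))\<bar> * F (polar u \<beta> p)))"
    by (auto simp: H_def fun_eq_iff indicator_def det)
  have "integrable lebesgue H"
    using cov(1) unfolding Hdet set_integrable_def .
  then show "integrable lborel H"
    using meas by (simp add: integrable_completion)
  have "(LINT p|lborel. H p) = (LINT p|lebesgue. H p)"
    using meas by (simp add: integral_completion)
  also have "\<dots> = integral polar_domain (\<lambda>p. \<bar>det (matrix (polar_deriv \<beta> p))\<bar> * F (polar u \<beta> p))"
    using set_lebesgue_integral_eq_integral(2)[OF cov(1)] by (simp add: Hdet set_lebesgue_integral_def)
  also have "\<dots> = integral (polar u \<beta> ` polar_domain) F"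
    by (rule cov(2))
  also have "\<dots> = integral UNIV F"
    unfolding image_polar Henstock_Kurzweil_Integration.integral_restrict_UNIV[of "{x. 0 < x $ 2}", symmetric]
    using supp by (intro arg_cong[of _ _ "integral UNIV"]) (auto simp: fun_eq_iff)
  also have "\<dots> = (LINT x|lborel. F x)"
    using F by (simp add: integral_lborel)
  finally show "(LINT p|lborel. H p) = (LINT x|lborel. F x)" .
qed

text \<open>In polar coordinates the volume element contributes the squared radius. Division by the
  distance leaves the factor \<open>r\<close> of the weighted ray integral, and the normalized inner
  product with the axis becomes \<open>s\<close>. The integral is therefore that of
  \<open>s ^ k * conical_radon f u \<beta> s\<close> over \<open>s\<close>.\<close>

lemma conical_radon_moment:
  fixes f :: "real^3 \<Rightarrow> real"
  assumes f: "continuous_on UNIV f" and K: "compact K" and supp: "\<And>x. x \<notin> K \<Longrightarrow> f x = 0"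
    and K2: "\<And>x. x \<in> K \<Longrightarrow> 0 < x $ 2"
    and zero: "\<And>s. s \<in> {-1..1} \<Longrightarrow> conical_radon f u \<beta> s = 0"
  shows "(LINT x:K|lborel. f x / norm (x - vector [u, 0, 0]) *
     ((x - vector [u, 0, 0]) \<bullet> cone_axis \<beta> / norm (x - vector [u, 0, 0])) ^ k) = 0"
proof -
  define F where "F x = f x / norm (x - vector [u, 0, 0]) *
     ((x - vector [u, 0, 0]) \<bullet> cone_axis \<beta> / norm (x - vector [u, 0, 0])) ^ k" for x
  have F0: "F x = 0" if "x \<notin> K" for x
    using supp[OF that] by (simp add: F_def)
  have nz: "x \<noteq> vector [u, 0, 0]" if "x \<in> K" for x
    using K2[OF that] by auto
  have "continuous_on K F"
    unfolding F_def by (intro continuous_intros continuous_on_subset[OF f]) (auto dest: nz)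
  from borel_integrable_compact[OF K this] have "integrable lborel (\<lambda>x. indicator K x *\<^sub>R F x)" .
  also have "(\<lambda>x. indicator K x *\<^sub>R F x) = F"
    using F0 by (auto simp: indicator_def fun_eq_iff)
  finally have F: "integrable lborel F" .
  have Fpos: "0 < x $ 2" if "F x \<noteq> 0" for x
    using that F0 K2 by blast
  \<comment> \<open>This is the iterated integrand of the transform on its full parameter box, which
    is larger than \<open>polar_domain\<close>.\<close>
  define H where "H p = (indicator {0..} (p$1) * indicator {-1..1} (p$2) * indicator {0..<2*pi} (p$3)) *
    ((p$2) ^ k * (f (polar u \<beta> p) * p$1))" for p
  have H: "H = (\<lambda>p. indicator polar_domain p * ((p$1)\<^sup>2 * F (polar u \<beta> p)))"
  proof
    fix p :: "real^3"
    show "H p = indicator polar_domain p * ((p$1)\<^sup>2 * F (polar u \<beta> p))"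
    proof (cases "p \<in> polar_domain")
      case True
      then have "norm (polar u \<beta> p - vector [u, 0, 0]) = p$1"
        by (intro norm_polar) (auto simp: polar_domain_def)
      then show ?thesis
        using True polar_components(1)[of u \<beta> p]
        by (auto simp: H_def F_def polar_domain_def cone_axis_def power2_eq_square)
    next
      case False
      \<comment> \<open>A nonzero value in the box would force a positive second coordinate, hence a
        positive radius, \<open>p$2\<close> strictly inside its range and a positive cosine,
        contradicting \<open>False\<close>.\<close>
      have "f (polar u \<beta> p) * p$1 = 0" if p: "0 \<le> p$1" "-1 \<le> p$2" "p$2 \<le> 1" "0 \<le> p$3" "p$3 < 2*pi"
      proof (rule ccontr)
        assume nz: "f (polar u \<beta> p) * p$1 \<noteq> 0"
        then have "0 < polar u \<beta> p $ 2"
          using supp K2 by (metis mult_zero_left)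
        then have pos: "0 < p$1 * (sqrt (1 - (p$2)\<^sup>2) * cos (p$3))"
          using polar_components(2)[of u \<beta> p] by simp
        have "0 \<le> sqrt (1 - (p$2)\<^sup>2)"
          using p by (simp add: abs_square_le_1 abs_le_iff)
        with pos p(1) have "0 < p$1" "0 < sqrt (1 - (p$2)\<^sup>2)" "0 < cos (p$3)"
          by (auto simp: zero_less_mult_iff)
        then have "p \<in> polar_domain"
          using p abs_square_less_1[of "p$2"] by (auto simp: polar_domain_def abs_less_iff)
        with False show False ..
      qed
      then show ?thesis
        using False by (auto simp: H_def indicator_def)
    qed
  qed
  have contp: "continuous_on UNIV (polar u \<beta>)"
    unfolding polar_def by (intro continuous_intros)
  have measH: "H \<in> borel_measurable borel"
  proof -
    have "(\<lambda>p::real^3. p $ i) \<in> borel_measurable borel" for i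
      by (intro borel_measurable_continuous_onI continuous_intros)
    moreover have "(\<lambda>p. f (polar u \<beta> p)) \<in> borel_measurable borel"
      by (intro borel_measurable_continuous_onI continuous_on_compose2[OF f contp]) auto
    ultimately show ?thesis
      unfolding H_def[abs_def] by measurable
  qed
  note pull = polar_pullback[OF F Fpos, of u \<beta>, folded H, OF _ measH]
  let ?\<phi> = "\<lambda>(s, t, r). vector [r, s, t] :: real^3"
  define G where "G = (\<lambda>q. H (?\<phi> q))"
  have \<phi>: "?\<phi> = (\<lambda>p. fst p *\<^sub>R axis 2 1 + fst (snd p) *\<^sub>R axis 3 1 + snd (snd p) *\<^sub>R axis 1 1)"
    by (auto simp: fun_eq_iff vec_eq_iff forall_3 axis_def)
  have meas: "?\<phi> \<in> borel_measurable lborel"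
    unfolding \<phi> by (simp, intro borel_measurable_continuous_onI continuous_intros)
  have G: "integrable (lborel \<Otimes>\<^sub>M (lborel \<Otimes>\<^sub>M lborel)) G"
    unfolding lborel_prod G_def
    using pull(1) lborel_vec3 integrable_distr[OF meas, of H] by simp
  have G_split: "G (s, t, r) = indicator {-1..1} s * s ^ k * (indicator {0..<2*pi} t *
      (indicator {0..} r * (f (vector [u, 0, 0] + r *\<^sub>R (s *\<^sub>R cone_axis \<beta> + sqrt (1 - s\<^sup>2) *\<^sub>R
        (cos t *\<^sub>R vector [0, 1, 0] + sin t *\<^sub>R vector [- sin \<beta>, 0, cos \<beta>]))) * r)))" for s t r
    by (simp add: G_def H_def polar_def cone_axis_def)
  have inner: "(LINT t|lborel. LINT r|lborel. G (s, t, r)) = 0" for s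
  proof (cases "s \<in> {-1..1}")
    case True
    have "(LINT t|lborel. LINT r|lborel. G (s, t, r)) = s ^ k * (LINT t:{0..<2*pi}|lborel.
       weighted_ray_integral f u (s *\<^sub>R cone_axis \<beta> + sqrt (1 - s\<^sup>2) *\<^sub>R
        (cos t *\<^sub>R vector [0, 1, 0] + sin t *\<^sub>R vector [- sin \<beta>, 0, cos \<beta>])))"
      using True by (simp add: G_split weighted_ray_integral_def set_lebesgue_integral_def)
    \<comment> \<open>The closed angle range of the transform adds only the null set consisting of
      \<open>2*pi\<close>.\<close>
    also have "(LINT t:{0..<2*pi}|lborel.
       weighted_ray_integral f u (s *\<^sub>R cone_axis \<beta> + sqrt (1 - s\<^sup>2) *\<^sub>R
        (cos t *\<^sub>R vector [0, 1, 0] + sin t *\<^sub>R vector [- sin \<beta>, 0, cos \<beta>]))) = conical_radon f u \<beta> s"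
      unfolding conical_radon_def sphere_delta_integral_def set_lebesgue_integral_def
    proof (rule integral_cong_AE)
      have cont: "continuous_on UNIV (\<lambda>(t, r). f (vector [u, 0, 0] + r *\<^sub>R (s *\<^sub>R cone_axis \<beta> + sqrt (1 - s\<^sup>2) *\<^sub>R
        (cos t *\<^sub>R vector [0, 1, 0] + sin t *\<^sub>R vector [- sin \<beta>, 0, cos \<beta>]))) * r)"
        unfolding case_prod_beta by (intro continuous_intros continuous_on_compose2[OF f]) auto
      have [measurable]: "(\<lambda>(t, r). f (vector [u, 0, 0] + r *\<^sub>R (s *\<^sub>R cone_axis \<beta> + sqrt (1 - s\<^sup>2) *\<^sub>R
        (cos t *\<^sub>R vector [0, 1, 0] + sin t *\<^sub>R vector [- sin \<beta>, 0, cos \<beta>]))) * r)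
          \<in> borel_measurable (lborel \<Otimes>\<^sub>M lborel)"
        using borel_measurable_continuous_onI[OF cont] by (simp add: lborel_prod)
      have [measurable]: "(\<lambda>t. weighted_ray_integral f u (s *\<^sub>R cone_axis \<beta> + sqrt (1 - s\<^sup>2) *\<^sub>R
          (cos t *\<^sub>R vector [0, 1, 0] + sin t *\<^sub>R vector [- sin \<beta>, 0, cos \<beta>]))) \<in> borel_measurable lborel"
        unfolding weighted_ray_integral_def set_lebesgue_integral_def by measurable
      show "(\<lambda>t. indicator {0..<2*pi} t *\<^sub>R weighted_ray_integral f u (s *\<^sub>R cone_axis \<beta> + sqrt (1 - s\<^sup>2) *\<^sub>R
          (cos t *\<^sub>R vector [0, 1, 0] + sin t *\<^sub>R vector [- sin \<beta>, 0, cos \<beta>]))) \<in> borel_measurable lborel"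
        by measurable
      show "(\<lambda>t. indicator {0..2*pi} t *\<^sub>R weighted_ray_integral f u (s *\<^sub>R cone_axis \<beta> + sqrt (1 - s\<^sup>2) *\<^sub>R
          (cos t *\<^sub>R vector [0, 1, 0] + sin t *\<^sub>R vector [- sin \<beta>, 0, cos \<beta>]))) \<in> borel_measurable lborel"
        by measurable
    qed (use AE_lborel_singleton[of "2*pi"] in \<open>auto elim!: eventually_mono simp: indicator_def\<close>)
    finally show ?thesis using zero[OF True] by simp
  next
    case False
    then show ?thesis by (simp add: G_split)
  qed
  have "(LINT x:K|lborel. F x) = (LINT x|lborel. F x)"
    using F0 by (rule set_lborel_integral_eq_integral)
  also have "\<dots> = (LINT p|lborel. H p)"
    by (rule pull(2)[symmetric])
  also have "\<dots> = (LINT q|lborel. G q)"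
    unfolding G_def using measH meas by (subst lborel_vec3, subst integral_distr) auto
  also have "\<dots> = (LINT s|lborel. LINT q|lborel. G (s, q))"
    using lborel_pair.integral_fst'[OF G[unfolded lborel_prod[where 'a=real and 'b=real]]] by (simp add: lborel_prod)
  also have "\<dots> = (LINT s::real|lborel. 0)"
  proof (rule integral_cong_AE)
    show "AE s in lborel. (LINT q|lborel. G (s, q)) = 0"
      using lborel_pair.AE_integrable_fst'[OF G[unfolded lborel_prod[where 'a=real and 'b=real]]]
    proof eventually_elim
      case (elim s)
      then have "(LINT q|lborel. G (s, q)) = (LINT t|lborel. LINT r|lborel. G (s, t, r))"
        using lborel_pair.integral_fst'[of "\<lambda>q. G (s, q)"] by (simp add: lborel_prod)
      then show ?case by (simp add: inner)
    qed
  qed (use G in \<open>auto simp: lborel_prod\<close>)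
  finally show ?thesis by (simp add: F_def)
qed

section \<open>Separating moments in the axis angle and in the vertex\<close>

lemma Basis_real2: "(Basis :: (real \<times> real) set) = {(1, 0), (0, 1)}"
  by (auto simp: Basis_prod_def zero_prod_def)

lemma Basis_real3: "(Basis :: (real \<times> real \<times> real) set) = {(1, 0, 0), (0, 1, 0), (0, 0, 1)}"
  by (auto simp: Basis_prod_def zero_prod_def)

text \<open>For \<open>\<beta> = arctan t\<close> the inner product of the direction with the axis
  is \<open>cos \<beta>\<close> times a linear polynomial in \<open>t\<close>. After division by the
  power of the nonzero cosine, \<open>moment_expansion\<close> separates the mixed moments.\<close>

lemma direction_moment:
  fixes f :: "real^3 \<Rightarrow> real"
  assumes f: "continuous_on UNIV f" and K: "compact K" and supp: "\<And>x. x \<notin> K \<Longrightarrow> f x = 0"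
    and K2: "\<And>x. x \<in> K \<Longrightarrow> 0 < x $ 2"
    and zero: "\<And>\<beta> s. \<beta> \<in> {0..<2*pi} \<Longrightarrow> s \<in> {-1..1} \<Longrightarrow> conical_radon f u \<beta> s = 0"
  defines "N \<equiv> \<lambda>x. norm (x - vector [u, 0, 0])"
  shows "(LINT x:K|lborel. f x / N x * ((x $ 1 - u) / N x) ^ i * (x $ 3 / N x) ^ j) = 0"
proof -
  have N: "N x \<noteq> 0" if "x \<in> K" for x
    using K2[OF that] by (auto simp: N_def)
  have contN: "continuous_on K N"
    unfolding N_def by (intro continuous_intros)
  have fK: "continuous_on K f"
    using f by (rule continuous_on_subset) simp
  \<comment> \<open>The exponent \<open>i + j - j\<close> matches the pattern of
    \<open>moment_expansion\<close> at total degree \<open>i + j\<close>.\<close>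
  have "(LINT x:K|lborel. f x / N x * ((x $ 1 - u) / N x) ^ (i + j - j) * (x $ 3 / N x) ^ j) = 0"
  proof (rule moment_expansion[OF K])
    show "infinite {0::real<..}" by (rule infinite_Ioi)
    fix t :: real assume "t \<in> {0<..}"
    then have "0 < arctan t" "arctan t < 2 * pi"
      using arctan_ubound[of t] pi_gt_zero by (simp, linarith)
    then have mom: "(LINT x:K|lborel. f x / N x * ((x - vector [u, 0, 0]) \<bullet> cone_axis (arctan t) / N x) ^ (i + j)) = 0"
      unfolding N_def by (intro conical_radon_moment assms) auto
    have cos: "cos (arctan t) \<noteq> 0" by simp
    have "sin (arctan t) = cos (arctan t) * t"
      using tan_arctan[of t] cos by (simp add: tan_def field_simps)
    then have "(x - vector [u, 0, 0]) \<bullet> cone_axis (arctan t) / N x =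
       cos (arctan t) * ((x $ 1 - u) / N x + t * (x $ 3 / N x))" for x
      by (simp add: cone_axis_def inner_vec_def sum_3 add_divide_distrib diff_divide_distrib algebra_simps)
    then have "f x / N x * ((x - vector [u, 0, 0]) \<bullet> cone_axis (arctan t) / N x) ^ (i + j) =
       cos (arctan t) ^ (i + j) * (f x / N x * ((x $ 1 - u) / N x + t * (x $ 3 / N x)) ^ (i + j))" for x
      by (simp only: power_mult_distrib ac_simps)
    with mom have "cos (arctan t) ^ (i + j) *
        (LINT x:K|lborel. f x / N x * ((x $ 1 - u) / N x + t * (x $ 3 / N x)) ^ (i + j)) = 0"
      by (simp only: set_integral_mult_right)
    with cos show "(LINT x:K|lborel. f x / N x * ((x $ 1 - u) / N x + t * (x $ 3 / N x)) ^ (i + j)) = 0"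
      by (simp only: mult_eq_0_iff power_eq_0_iff) blast
  qed (use N in \<open>auto intro!: continuous_intros contN fK\<close>)
  then show ?thesis by simp
qed

text \<open>Quotients of direction components are quotients of coordinates, free of the distance
  \<open>N x\<close>. The extra factor \<open>inverse (snd y)\<close> in \<open>h\<close> equals
  \<open>N x / x $ 3\<close> and cancels the weight \<open>1 / N x\<close>. The square root in
  \<open>h\<close> recovers the second component because that component is positive on
  \<open>K\<close>.\<close>

lemma perspective_moment:
  fixes f :: "real^3 \<Rightarrow> real"
  assumes f: "continuous_on UNIV f" and K: "compact K" and supp: "\<And>x. x \<notin> K \<Longrightarrow> f x = 0"
    and K2: "\<And>x. x \<in> K \<Longrightarrow> 0 < x $ 2" and K3: "\<And>x. x \<in> K \<Longrightarrow> 0 < x $ 3"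
    and zero: "\<And>\<beta> s. \<beta> \<in> {0..<2*pi} \<Longrightarrow> s \<in> {-1..1} \<Longrightarrow> conical_radon f u \<beta> s = 0"
  shows "(LINT x:K|lborel. f x / x $ 3 * (x $ 2 / x $ 3) ^ m * ((x $ 1 - u) / x $ 3) ^ k) = 0"
proof -
  define N where "N = (\<lambda>x::real^3. norm (x - vector [u, 0, 0]))"
  have N: "0 < N x" if "x \<in> K" for x
    using K2[OF that] by (auto simp: N_def)
  have contN: "continuous_on K N"
    unfolding N_def by (intro continuous_intros)
  have fK: "continuous_on K f"
    using f by (rule continuous_on_subset) simp
  define T where "T x = ((x $ 1 - u) / N x, x $ 3 / N x)" for x :: "real^3"
  define h where "h y = inverse (snd y) * (sqrt (1 - (fst y)\<^sup>2 - (snd y)\<^sup>2) / snd y) ^ m * (fst y / snd y) ^ k"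
    for y :: "real \<times> real"
  have "(LINT x:K|lborel. f x / N x * h (T x)) = 0"
  proof (rule integral_weighted_moments_eq_zero[OF K, where T = T and h = h])
    show "continuous_on K (\<lambda>x. f x / N x)" "continuous_on K T"
      unfolding T_def by (auto intro!: continuous_intros contN fK dest: N)
    show "continuous_on (T ` K) h"
      unfolding h_def by (intro continuous_intros) (auto simp: T_def dest: N K3)
    show "(LINT x:K|lborel. f x / N x * (\<Prod>b\<in>Basis. (T x \<bullet> b) ^ n b)) = 0" for n
      using direction_moment[OF f K supp K2 zero, where i = "n (1, 0)" and j = "n (0, 1)"]
      by (simp add: Basis_real2 T_def N_def mult.assoc)
  qed
  moreover have "f x / N x * h (T x) = f x / x $ 3 * (x $ 2 / x $ 3) ^ m * ((x $ 1 - u) / x $ 3) ^ k"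
    if "x \<in> K" for x
  proof -
    note pos = N[OF that] K2[OF that] K3[OF that]
    have "(x $ 2)\<^sup>2 = (N x)\<^sup>2 - (x $ 1 - u)\<^sup>2 - (x $ 3)\<^sup>2"
      unfolding N_def power2_norm_eq_inner by (simp add: inner_vec_def sum_3 power2_eq_square)
    then have "1 - ((x $ 1 - u) / N x)\<^sup>2 - (x $ 3 / N x)\<^sup>2 = (x $ 2 / N x)\<^sup>2"
      using pos unfolding power_divide by (simp add: diff_divide_distrib)
    then have "sqrt (1 - ((x $ 1 - u) / N x)\<^sup>2 - (x $ 3 / N x)\<^sup>2) = x $ 2 / N x"
      using pos by simp
    then show ?thesis
      using pos by (simp add: h_def T_def)
  qed
  ultimately show ?thesis
    using K by (subst (asm) set_lebesgue_integral_cong) (auto intro: borel_compact)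
qed

text \<open>The perspective moment is a polynomial in \<open>u\<close>, since
  \<open>(x $ 1 - u) / x $ 3\<close> is \<open>x $ 1 / x $ 3 + u * (- 1 / x $ 3)\<close>. Here the
  infinitude of \<open>A\<close> enters; the sign \<open>(- 1) ^ c\<close> is divided out at the
  end.\<close>

lemma projective_moment:
  fixes f :: "real^3 \<Rightarrow> real"
  assumes f: "continuous_on UNIV f" and K: "compact K" and supp: "\<And>x. x \<notin> K \<Longrightarrow> f x = 0"
    and K2: "\<And>x. x \<in> K \<Longrightarrow> 0 < x $ 2" and K3: "\<And>x. x \<in> K \<Longrightarrow> 0 < x $ 3"
    and A: "infinite A"
    and zero: "\<And>u \<beta> s. u \<in> A \<Longrightarrow> \<beta> \<in> {0..<2*pi} \<Longrightarrow> s \<in> {-1..1} \<Longrightarrow> conical_radon f u \<beta> s = 0"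
  shows "(LINT x:K|lborel. f x / x $ 3 * ((x $ 1 / x $ 3) ^ a * (x $ 2 / x $ 3) ^ b * (1 / x $ 3) ^ c)) = 0"
proof -
  have fK: "continuous_on K f"
    using f by (rule continuous_on_subset) simp
  have "(LINT x:K|lborel. f x / x $ 3 * (x $ 2 / x $ 3) ^ b * (x $ 1 / x $ 3) ^ (a + c - c) * (- 1 / x $ 3) ^ c) = 0"
  proof (rule moment_expansion[OF K _ _ _ A])
    fix u assume "u \<in> A"
    from perspective_moment[OF f K supp K2 K3 zero[OF this], where m = b and k = "a + c"]
    show "(LINT x:K|lborel. f x / x $ 3 * (x $ 2 / x $ 3) ^ b * (x $ 1 / x $ 3 + u * (- 1 / x $ 3)) ^ (a + c)) = 0"
      by (simp add: diff_divide_distrib)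
  qed (auto intro!: continuous_intros fK dest: K3)
  moreover have "f y / y $ 3 * (y $ 2 / y $ 3) ^ b * (y $ 1 / y $ 3) ^ (a + c - c) * (- 1 / y $ 3) ^ c =
      (- 1) ^ c * (f y / y $ 3 * ((y $ 1 / y $ 3) ^ a * (y $ 2 / y $ 3) ^ b * (1 / y $ 3) ^ c))" for y
  proof -
    have "(- 1 / y $ 3) ^ c = (- 1) ^ c * (1 / y $ 3) ^ c"
      by (simp flip: power_mult_distrib)
    then show ?thesis by (simp only: add_diff_cancel_right' ac_simps)
  qed
  ultimately show ?thesis
    by (simp only: set_integral_mult_right) simp
qed

section \<open>From vanishing moments to the vanishing of the function\<close>

text \<open>The set where \<open>f\<close> is nonzero is null, and it is open by continuity, hence
  empty.\<close>

lemma continuous_eq_zero_if_integral_square: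
  fixes f :: "'a::euclidean_space \<Rightarrow> real"
  assumes f: "continuous_on UNIV f" and K: "compact K" and supp: "\<And>x. x \<notin> K \<Longrightarrow> f x = 0"
    and int: "(LINT x:K|lborel. (f x)\<^sup>2) = 0"
  shows "f = (\<lambda>x. 0)"
proof -
  have "AE x in lborel. indicator K x *\<^sub>R (f x)\<^sup>2 = 0"
  proof -
    have "integrable lborel (\<lambda>x. indicator K x *\<^sub>R (f x)\<^sup>2)"
      by (intro borel_integrable_compact K continuous_intros continuous_on_subset[OF f]) simp
    then show ?thesis
      using int unfolding set_lebesgue_integral_def
      by (subst (asm) integral_nonneg_eq_0_iff_AE) auto
  qed
  then have "AE x in lborel. f x = 0"
    by eventually_elim (use supp in \<open>auto simp: indicator_def split: if_splits\<close>)
  then have "AE x in lebesgue. x \<notin> {x. f x \<noteq> 0}"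
    by (simp add: AE_completion)
  moreover have op: "open {x. f x \<noteq> 0}"
    using f by (intro open_Collect_neq continuous_intros)
  ultimately have "negligible {x. f x \<noteq> 0}"
    unfolding negligible_iff_null_sets by (subst AE_iff_null_sets) auto
  with op have "{x. f x \<noteq> 0} = {}"
    using open_not_negligible by blast
  then show ?thesis by (auto simp: fun_eq_iff)
qed

theorem theorem4:
  fixes f :: "real^3 \<Rightarrow> real" and U :: "(real^3) set" and A :: "real set"
  assumes "U = {x. norm (x - vector [0, 0, 1]) < 1 \<and> x $ 2 > 0}"
    and "infinite A"
    and "smooth f"
    and "compact_support_in f U"
    and "\<forall>u\<in>A. \<forall>\<beta>\<in>{0..<2*pi}. \<forall>s\<in>{-1..1}. conical_radon f u \<beta> s = 0"
  shows "f = (\<lambda>x. 0)"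
proof -
  define K where "K = topological_support f"
  have K: "compact K" "K \<subseteq> U"
    using assms(4) by (simp_all add: K_def compact_support_in_def)
  have supp: "f x = 0" if "x \<notin> K" for x
    using that closure_subset[of "{x. f x \<noteq> 0}"] by (auto simp: K_def topological_support_def)
  have "continuously_differentiable_times 0 f"
    using assms(3) unfolding smooth_def ..
  then have f: "continuous_on UNIV f"
    by simp
  have K2: "0 < x $ 2" if "x \<in> K" for x
    using that K(2) assms(1) by auto
  \<comment> \<open>The open unit ball about \<open>(0, 0, 1)\<close> lies above the plane
    containing the vertices, so division by \<open>x $ 3\<close> is safe.\<close>
  have K3: "0 < x $ 3" if "x \<in> K" for x
  proof -
    have "\<bar>(x - vector [0, 0, 1]) $ 3\<bar> < 1"
      using that K(2) assms(1) component_le_norm_cart[of "x - vector [0, 0, 1]" 3] by auto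
    then show ?thesis by simp
  qed
  have fK: "continuous_on K f"
    using f by (rule continuous_on_subset) simp
  define T where "T x = (x $ 1 / x $ 3, x $ 2 / x $ 3, 1 / x $ 3)" for x :: "real^3"
  \<comment> \<open>A left inverse of \<open>T\<close> on \<open>K\<close>: through it every
    continuous function on \<open>K\<close> factors through \<open>T\<close>.\<close>
  define g where "g y = (vector [fst y / snd (snd y), fst (snd y) / snd (snd y), 1 / snd (snd y)] :: real^3)"
    for y :: "real \<times> real \<times> real"
  have g: "g (T x) = x" if "x \<in> K" for x
    using K3[OF that] by (simp add: g_def T_def vec_eq_iff forall_3)
  have contg: "continuous_on (T ` K) g"
  proof -
    have "g = (\<lambda>y. (fst y / snd (snd y)) *\<^sub>R axis 1 1 + (fst (snd y) / snd (snd y)) *\<^sub>R axis 2 1 + (1 / snd (snd y)) *\<^sub>R axis 3 1)"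
      by (simp add: fun_eq_iff g_def vec_eq_iff forall_3 axis_def)
    then show ?thesis
      by (auto intro!: continuous_intros simp: T_def dest: K3)
  qed
  \<comment> \<open>The last component of \<open>T x\<close> is \<open>1 / x $ 3\<close>; dividing
    by it cancels the weight, so the integrand is the square of \<open>f\<close> on
    \<open>K\<close>.\<close>
  have "(LINT x:K|lborel. f x / x $ 3 * (f (g (T x)) / snd (snd (T x)))) = 0"
  proof (rule integral_weighted_moments_eq_zero[OF K(1), where T = T and h = "\<lambda>y. f (g y) / snd (snd y)"])
    show "continuous_on K (\<lambda>x. f x / x $ 3)" "continuous_on K T"
      unfolding T_def by (auto intro!: continuous_intros fK dest: K3)
    show "continuous_on (T ` K) (\<lambda>y. f (g y) / snd (snd y))"
      by (intro continuous_intros continuous_on_compose2[OF f contg]) (auto simp: T_def dest: K3)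
    show "(LINT x:K|lborel. f x / x $ 3 * (\<Prod>b\<in>Basis. (T x \<bullet> b) ^ n b)) = 0" for n
      using projective_moment[OF f K(1) supp K2 K3 assms(2), where a = "n (1, 0, 0)" and b = "n (0, 1, 0)" and c = "n (0, 0, 1)"] assms(5)
      by (simp add: Basis_real3 T_def mult.assoc)
  qed
  moreover have "f x / x $ 3 * (f (g (T x)) / snd (snd (T x))) = (f x)\<^sup>2" if "x \<in> K" for x
    unfolding g[OF that] using K3[OF that] by (simp add: T_def power2_eq_square)
  ultimately have "(LINT x:K|lborel. (f x)\<^sup>2) = 0"
    using K(1) by (subst (asm) set_lebesgue_integral_cong) (auto intro: borel_compact)
  from continuous_eq_zero_if_integral_square[OF f K(1) supp this] show ?thesis .
qed

end
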